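(* For every $n\ge 1$ and every partition $\pi\in\Pi_n$, $$\nu(121,\pi)\leq\nu(121,\alpha_n).$$
   Context: Let $[n]=\{1,\dots,n\}$. A partition of $[n]$ into disjoint nonempty blocks $B_1/B_2/\cdots/B_t$, ordered so that $\min B_1<\min B_2<\cdots<\min B_t$, is identified with the word $\pi_1\pi_2\cdots\pi_n$ where $\pi_i=j$ iff $i\in B_j$. $\Pi_n$ is the set of all partitions of $[n]$ (as words). The canonization of a word is obtained by replacing all occurrences of the first letter by 1, all occurrences of the second distinct letter to appear by 2, and so on. $\nu(121,\sigma)$ is the number of copies of $121$ in $\sigma=\sigma_1\cdots\sigma_n$ in the unrestricted sense: the number of triples of positions $i_1<i_2<i_3$ such that the canonization of $\sigma_{i_1}\sigma_{i_2}\sigma_{i_3}$ is $121$ (equivalently $\sigma_{i_1}=\sigma_{i_3}\neq\sigma_{i_2}$). $\alpha_n$ denotes the alternating partition of length $n$: the word $1212\cdots$ of length $n$ with $1$ in odd positions and $2$ in even positions. *)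

theory Defs
  imports "HOL-Library.Disjoint_Sets"
begin

(* The word of a partition B_1/.../B_t of {1..n} (blocks listed by increasing minimum)
   has letter j at position i iff i lies in B_j.  Positions and block numbers start at 1,
   list indices at 0, hence the shifts. *)

definition set_partitions :: "nat \<Rightarrow> nat list set" where
  "set_partitions n = {w. length w = n \<and>
     (\<exists>Bs. partition_on {1..n} (set Bs) \<and>
           sorted_wrt (\<lambda>B C. Min B < Min C) Bs \<and>
           (\<forall>i\<in>{1..n}. \<forall>j\<in>{1..length Bs}. w ! (i - 1) = j \<longleftrightarrow> i \<in> Bs ! (j - 1)))}"

(* takeWhile (\<lambda>y. y \<noteq> x) w is the part of w before the first occurrence of x, so a letter that
   is the k-th distinct one to appear is replaced by k. *)

definition canonization :: "'a list \<Rightarrow> nat list" where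
  "canonization w = map (\<lambda>x. card (set (takeWhile (\<lambda>y. y \<noteq> x) w)) + 1) w"

(* nths \<sigma> I is the subsequence of \<sigma> at the positions in I (in increasing order), so copies are
   counted by position sets; for a pattern of length 3 these are the triples i1 < i2 < i3. *)

definition pattern_count :: "nat list \<Rightarrow> 'a list \<Rightarrow> nat" where
  "pattern_count \<tau> \<sigma> = card {I. I \<subseteq> {..<length \<sigma>} \<and> canonization (nths \<sigma> I) = \<tau>}"

definition alternating_partition :: "nat \<Rightarrow> nat list" where
  "alternating_partition n = map (\<lambda>i. if odd i then 1 else 2) [1..<Suc n]"

end

theory Submission
  imports Defs
begin

text \<open>
  A copy of 121 in a word is a triple of positions \<open>i < j < k\<close> whose outer two letters agree and
  whose middle letter differs. The proof is an induction on arbitrary words that removes two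
  positions at a time.

  Let \<open>a\<close> be a most frequent letter of a word of length \<open>n\<close>, occurring \<open>m\<close> times. If \<open>m \<le> 1\<close>
  there are no copies. Otherwise remove its first occurrence \<open>p\<close> and its last occurrence \<open>q\<close>.
  Each destroyed copy involves \<open>a\<close> and exactly one other letter \<open>b\<close>. Say that \<open>b\<close> occurs \<open>l\<close> times before \<open>p\<close>, \<open>c\<close> times between \<open>p\<close> and \<open>q\<close>, and \<open>r\<close>
  times after \<open>q\<close>. A \<open>b\<close> between \<open>p\<close> and \<open>q\<close> is the middle of \<open>m - 1\<close> destroyed copies: one for each
  \<open>a\<close> other than \<open>p\<close>, paired with whichever of \<open>p\<close>, \<open>q\<close> lies on the opposite side of this \<open>b\<close>, where
  the pair \<open>(p, q)\<close> counts once. The copies with outer letters \<open>b\<close> and middle \<open>p\<close> or \<open>q\<close> number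
  \<open>l (c + r) + (l + c) r\<close>. Because \<open>l + c + r \<le> m\<close>, the two contributions add up to at most
  \<open>(l + c + r) (m - 1)\<close>: an occurrence of \<open>b\<close> outside the interval never costs more, on average,
  than one inside. Summing over \<open>b\<close>, at most \<open>(n - m) (m - 1)\<close> copies are lost. The two factors
  have sum \<open>n - 1\<close>, so this is at most \<open>\<lfloor>(n - 1)/2\<rfloor> \<lceil>(n - 1)/2\<rceil>\<close>
  (\<open>card_copies_121_remove_extremes\<close>, \<open>mult_le_balanced\<close>).

  In the alternating word, position \<open>k\<close> (counted from 0) ends \<open>1 + 2 + \<dots> + \<lfloor>k/2\<rfloor>\<close> copies, since
  two equal letters at distance \<open>2 d\<close> enclose \<open>d\<close> different ones. Adding the contributions of
  \<open>k = n - 2\<close> and \<open>k = n - 1\<close> gives exactly the same product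
  (\<open>alternating_total_step\<close>). Hence the number of copies in an arbitrary word grows, per two
  positions, by no more than it does in the alternating word.
\<close>

section \<open>Copies of 121 as triples of positions\<close>

text \<open>
  The position set is a parameter so that letters can be deleted from a word without renumbering
  the remaining positions.
\<close>

definition copies_121 :: "('i::linorder \<Rightarrow> 'a) \<Rightarrow> 'i set \<Rightarrow> ('i \<times> 'i \<times> 'i) set" where
  "copies_121 f S =
     {(i, j, k) \<in> S \<times> S \<times> S. i < j \<and> j < k \<and> f i = f k \<and> f j \<noteq> f i}"

lemma finite_copies_121: "finite S \<Longrightarrow> finite (copies_121 f S)"
  unfolding copies_121_def by (rule finite_subset[of _ "S \<times> S \<times> S"]) auto

lemma nths_singleton_index:
  assumes "i < length xs"
  shows "nths xs {i} = [xs ! i]"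
  using assms
proof (induction xs arbitrary: i)
  case (Cons x xs)
  then show ?case by (cases i) (auto simp: nths_Cons)
qed simp

lemma nths_pair:
  assumes "i < j" "j < length xs"
  shows "nths xs {i, j} = [xs ! i, xs ! j]"
  using assms
proof (induction xs arbitrary: i j)
  case (Cons x xs)
  then obtain j' where j: "j = Suc j'" by (cases j) auto
  then show ?case
  proof (cases i)
    case 0
    have "{l. l = j'} = {j'}" by auto
    then show ?thesis using 0 j Cons.prems nths_singleton_index[of j' xs] by (simp add: nths_Cons)
  next
    case (Suc i')
    have "{l. l = i' \<or> l = j'} = {i', j'}" by auto
    then show ?thesis using Suc j Cons.prems Cons.IH[of i' j'] by (simp add: nths_Cons)
  qed
qed simp

lemma nths_triple:
  assumes "i < j" "j < k" "k < length xs"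
  shows "nths xs {i, j, k} = [xs ! i, xs ! j, xs ! k]"
  using assms
proof (induction xs arbitrary: i j k)
  case (Cons x xs)
  then obtain j' k' where jk: "j = Suc j'" "k = Suc k'" by (cases j; cases k) auto
  then show ?case
  proof (cases i)
    case 0
    have "{l. l = j' \<or> l = k'} = {j', k'}" by auto
    then show ?thesis using 0 jk Cons.prems nths_pair[of j' k' xs] by (simp add: nths_Cons)
  next
    case (Suc i')
    have "{l. l = i' \<or> l = j' \<or> l = k'} = {i', j', k'}" by auto
    then show ?thesis using Suc jk Cons.prems Cons.IH[of i' j' k'] by (simp add: nths_Cons)
  qed
qed simp

lemma canonization_eq_121_iff: "canonization [x, y, z] = [1, 2, 1] \<longleftrightarrow> x = z \<and> y \<noteq> x"
  \<comment> \<open>The simproc would read \<open>set\<close> of the conditional lists from \<open>takeWhile\<close> as a comprehension.\<close>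
  using [[simproc del: list_to_set_comprehension]] by (auto simp: canonization_def)

lemma card_3_sorted:
  fixes I :: "'i::linorder set"
  assumes "card I = 3"
  obtains i j k where "I = {i, j, k}" "i < j" "j < k"
proof -
  define xs where "xs = sorted_list_of_set I"
  have fin: "finite I" using assms card_ge_0_finite by force
  have "length xs = 3" using assms by (simp add: xs_def)
  then obtain i j k where "xs = [i, j, k]" 
    by (auto simp: eval_nat_numeral length_Suc_conv)
  moreover have "sorted_wrt (<) xs" "set xs = I" using fin by (simp_all add: xs_def)
  ultimately show thesis using that[of i j k] by auto
qed

lemma pattern_count_121_eq_card_copies:
  "pattern_count [1, 2, 1] \<sigma> = card (copies_121 (\<lambda>i. \<sigma> ! i) {..<length \<sigma>})"
proof -
  let ?T = "copies_121 (\<lambda>i. \<sigma> ! i) {..<length \<sigma>}"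
  let ?I = "{I. I \<subseteq> {..<length \<sigma>} \<and> canonization (nths \<sigma> I) = [1, 2, 1]}"
  have sorted: "sorted_list_of_set {i, j, k} = [i, j, k]" if "i < j" "j < k" for i j k :: nat
    using sorted_list_of_set.idem_if_sorted_distinct[of "[i, j, k]"] that by simp
  have "bij_betw (\<lambda>(i, j, k). {i, j, k}) ?T ?I"
    unfolding bij_betw_def
  proof
    show "inj_on (\<lambda>(i, j, k). {i, j, k}) ?T"
    proof (rule inj_onI)
      fix t t'
      assume tt: "t \<in> ?T" "t' \<in> ?T"
        and eq: "(\<lambda>(i, j, k). {i, j, k}) t = (\<lambda>(i, j, k). {i, j, k}) t'"
      obtain i j k where t: "t = (i, j, k)" by (cases t)
      obtain i' j' k' where t': "t' = (i', j', k')" by (cases t')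
      have "sorted_list_of_set {i, j, k} = [i, j, k]"
        and "sorted_list_of_set {i', j', k'} = [i', j', k']"
        using tt unfolding t t' copies_121_def by (blast intro: sorted)+
      moreover have "{i, j, k} = {i', j', k'}" using eq unfolding t t' by simp
      ultimately have "[i, j, k] = [i', j', k']" by metis
      then show "t = t'" unfolding t t' by simp
    qed
    show "(\<lambda>(i, j, k). {i, j, k}) ` ?T = ?I"
    proof
      show "(\<lambda>(i, j, k). {i, j, k}) ` ?T \<subseteq> ?I"
      proof (rule image_subsetI)
        fix t
        assume "t \<in> ?T"
        moreover obtain i j k where t: "t = (i, j, k)" by (cases t)
        ultimately have "i < j" "j < k" "k < length \<sigma>" "\<sigma> ! i = \<sigma> ! k" "\<sigma> ! j \<noteq> \<sigma> ! i"
          unfolding copies_121_def by auto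
        then have "{i, j, k} \<subseteq> {..<length \<sigma>} \<and> canonization (nths \<sigma> {i, j, k}) = [1, 2, 1]"
          by (simp only: nths_triple canonization_eq_121_iff) simp
        then show "(\<lambda>(i, j, k). {i, j, k}) t \<in> ?I" using t by simp
      qed
    next
      show "?I \<subseteq> (\<lambda>(i, j, k). {i, j, k}) ` ?T"
      proof
        fix I
        assume "I \<in> ?I"
        then have I: "I \<subseteq> {..<length \<sigma>}" "canonization (nths \<sigma> I) = [1, 2, 1]" by simp_all
        then have "length (canonization (nths \<sigma> I)) = 3" by simp
        then have "length (nths \<sigma> I) = 3" by (simp add: canonization_def)
        moreover have "{i. i < length \<sigma> \<and> i \<in> I} = I" using I(1) by auto
        ultimately have "card I = 3" by (simp add: length_nths)
        then obtain i j k where ijk: "I = {i, j, k}" "i < j" "j < k" by (rule card_3_sorted)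
        then have len: "k < length \<sigma>" using I(1) by simp
        have "\<sigma> ! i = \<sigma> ! k \<and> \<sigma> ! j \<noteq> \<sigma> ! i"
          using I(2) unfolding ijk(1) nths_triple[OF ijk(2,3) len] canonization_eq_121_iff .
        then have "(i, j, k) \<in> ?T" using ijk len unfolding copies_121_def by auto
        then show "I \<in> (\<lambda>(i, j, k). {i, j, k}) ` ?T" by (rule rev_image_eqI) (simp add: ijk(1))
      qed
    qed
  qed
  then show ?thesis unfolding pattern_count_def by (simp add: bij_betw_same_card)
qed

section \<open>Copies of 121 in the alternating word\<close>

text \<open>
  The summand for \<open>k\<close> counts the copies that end at position \<open>k\<close> of the alternating word: the equal
  letter at position \<open>k - 2 d\<close> can be the first, with \<open>d\<close> possible middles.
\<close>

definition alternating_total :: "nat \<Rightarrow> nat" where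
  "alternating_total n = (\<Sum>k<n. \<Sum>d\<le>k div 2. d)"

text \<open>
  The increment is a sum of two triangular numbers with equal or consecutive indices. It is the
  largest value of a product of two natural numbers with sum \<open>n + 1\<close>, which is what the removal
  argument for arbitrary words produces.
\<close>

lemma alternating_total_step:
  "alternating_total (n + 2) = alternating_total n + (n + 1) div 2 * ((n + 2) div 2)"
proof -
  \<comment> \<open>Doubling clears the division in the closed form of the triangular numbers.\<close>
  have "2 * ((\<Sum>d\<le>n div 2. d) + (\<Sum>d\<le>Suc n div 2. d)) = 2 * ((n + 1) div 2 * ((n + 2) div 2))"
  proof (cases "even n")
    case True
    then obtain q where "n = 2 * q" by blast
    then show ?thesis using gauss_sum_nat[of q] by (simp add: atMost_atLeast0)
  next
    case False
    then obtain q where "n = 2 * q + 1" by (rule oddE)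
    then show ?thesis using gauss_sum_nat[of q] by (simp add: atMost_atLeast0)
  qed
  then show ?thesis by (simp add: alternating_total_def)
qed

text \<open>
  For counting copies of 121 only the equalities between letters matter, so the alternating word
  is represented by the parity predicate.
\<close>

lemma alternating_total_le_card_copies: "alternating_total n \<le> card (copies_121 even {..<n})"
proof (induction n)
  case (Suc n)
  \<comment> \<open>Copies ending at \<open>n\<close>: \<open>d\<close> picks the first position, \<open>e < d\<close> one of the \<open>d\<close> middles after it.\<close>
  let ?g = "\<lambda>(d, e). (n - 2 * d, n - 2 * e - 1, n)"
  let ?P = "Sigma {..n div 2} (\<lambda>d. {..<d})"
  have bounds: "e < d \<and> 2 * d \<le> n" if "(d, e) \<in> ?P" for d e using that by auto
  have inj: "inj_on ?g ?P"
  proof (rule inj_onI)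
    fix x y
    assume xy: "x \<in> ?P" "y \<in> ?P" and g: "?g x = ?g y"
    obtain d e where x: "x = (d, e)" by (cases x)
    obtain d' e' where y: "y = (d', e')" by (cases y)
    have le: "e < d" "2 * d \<le> n" "e' < d'" "2 * d' \<le> n" using xy bounds x y by blast+
    have "n - 2 * d = n - 2 * d'" "n - 2 * e - 1 = n - 2 * e' - 1" using g x y by simp_all
    with le have "d = d'" "e = e'" by linarith+
    then show "x = y" using x y by simp
  qed
  have sub: "?g ` ?P \<subseteq> copies_121 even {..<Suc n}"
  proof (rule image_subsetI)
    fix x
    assume xP: "x \<in> ?P"
    obtain d e where x: "x = (d, e)" by (cases x)
    have "e < d" "2 * d \<le> n" using xP bounds x by blast+
    moreover from this have "n - 2 * d < Suc n" "n - 2 * e - 1 < Suc n" "n - 2 * e - 1 < n" "n - 2 * d < n - 2 * e - 1"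
      by linarith+
    moreover from calculation have "odd (n - 2 * e - 1) \<longleftrightarrow> even n" by (simp add: even_diff_nat)
    ultimately show "?g x \<in> copies_121 even {..<Suc n}"
      unfolding x copies_121_def by simp
  qed
  have "alternating_total (Suc n) = alternating_total n + card (?g ` ?P)"
    unfolding card_image[OF inj] by (simp add: alternating_total_def)
  also have "\<dots> \<le> card (copies_121 even {..<n}) + card (?g ` ?P)" using Suc.IH by simp
  also have "\<dots> = card (copies_121 even {..<n} \<union> ?g ` ?P)"
    by (rule card_Un_disjoint[symmetric]) (auto simp: finite_copies_121, auto simp: copies_121_def)
  also have "\<dots> \<le> card (copies_121 even {..<Suc n})"
    using sub by (intro card_mono) (auto simp: finite_copies_121, auto simp: copies_121_def)
  finally show ?case .
qed (simp add: alternating_total_def)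

lemma pattern_count_121_alternating:
  "pattern_count [1, 2, 1] (alternating_partition n) = card (copies_121 even {..<n})"
proof -
  have len: "length (alternating_partition n) = n" by (simp add: alternating_partition_def)
  have nth: "alternating_partition n ! i = (if even i then 1 else 2)" if "i < n" for i
    using that unfolding alternating_partition_def by (subst nth_map) (simp_all del: upt_Suc)
  have "(i, j, k) \<in> copies_121 (\<lambda>i. alternating_partition n ! i) {..<n}
      \<longleftrightarrow> (i, j, k) \<in> copies_121 even {..<n}" for i j k
    by (cases "even i"; cases "even j"; cases "even k")
       (simp_all add: copies_121_def nth cong: conj_cong)
  then have "copies_121 (\<lambda>i. alternating_partition n ! i) {..<n} = copies_121 even {..<n}"
    by (simp add: set_eq_iff split_paired_all)
  then show ?thesis by (simp only: pattern_count_121_eq_card_copies len)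
qed

section \<open>Removing the first and last occurrence of a most frequent letter\<close>

text \<open>
  Cancelling \<open>m * (s - 1)\<close> leaves \<open>l m + m r + 2 l r \<le> (l + r) (s - 1)\<close>. For \<open>s = l + m + r\<close>
  the difference of the two sides is \<open>l\<^sup>2 - l + r\<^sup>2 - r\<close>, which is nonnegative for natural numbers;
  a larger \<open>s\<close> only increases the right-hand side.
\<close>

lemma removal_loss_arith:
  fixes l m r s :: nat
  assumes "l + m + r \<le> s"
  shows "m * (s - 1) + l * (m + r) + (l + m) * r \<le> (l + m + r) * (s - 1)"
proof -
  have "l * (m + r) + (l + m) * r \<le> (l + r) * (s - 1)"
  proof (cases "l + r = 0")
    case False
    have "l + r \<le> l * l + r * r" by (intro add_mono le_square)
    then have "l * (m + r) + (l + m) * r + (l + r) \<le> (l + r) * (l + m + r)"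
      by (simp add: algebra_simps)
    also have "\<dots> \<le> (l + r) * s" using assms by simp
    also have "\<dots> = (l + r) * (s - 1) + (l + r)" using False assms by (cases s) auto
    finally show ?thesis by simp
  qed auto
  moreover have "(l + m + r) * (s - 1) = m * (s - 1) + (l + r) * (s - 1)"
    by (simp only: add_mult_distrib)
  ultimately show ?thesis by linarith
qed

lemma mult_le_balanced:
  fixes x y :: nat
  shows "x * y \<le> (x + y) div 2 * ((x + y + 1) div 2)"
proof -
  \<comment> \<open>The case \<open>x \<le> y\<close>, with \<open>y = x + t\<close>.\<close>
  have *: "x * (x + t) \<le> (x + (x + t)) div 2 * ((x + (x + t) + 1) div 2)" for x t :: nat
  proof (cases "even t")
    case True
    then obtain q where "t = 2 * q" by blast
    then show ?thesis by (simp add: algebra_simps)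
  next
    case False
    then obtain q where "t = 2 * q + 1" by (rule oddE)
    then have "(x + (x + t)) div 2 = x + q" "(x + (x + t) + 1) div 2 = x + q + 1"
      and "t = 2 * q + 1" by simp_all
    then show ?thesis by (simp add: algebra_simps)
  qed
  show ?thesis
  proof (cases "x \<le> y")
    case True then show ?thesis using *[of x "y - x"] by simp
  next
    case False then show ?thesis using *[of y "x - y"] by (simp add: ac_simps)
  qed
qed

text \<open>
  Maximality of the class \<open>A\<close> is essential: a letter \<open>b\<close> more frequent than \<open>a\<close> could surround
  the removed positions with many copies \<open>b a b\<close>.
\<close>

lemma card_copies_121_remove_extremes:
  fixes f :: "'i::linorder \<Rightarrow> 'a"
  assumes fin: "finite S" and A: "A = {i \<in> S. f i = a}" and ne: "A \<noteq> {}"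
    and largest: "\<And>b. card {i \<in> S. f i = b} \<le> card A"
  shows "card (copies_121 f S)
    \<le> card (copies_121 f (S - {Min A, Max A})) + (card S - card A) * (card A - 1)"
proof -
  define p q where "p = Min A" and "q = Max A"
  have finA: "finite A" using fin A by simp
  have pq: "p \<in> A" "q \<in> A" and le: "\<And>i. i \<in> A \<Longrightarrow> p \<le> i \<and> i \<le> q"
    using finA ne by (auto simp: p_def q_def)
  have fpq: "f p = a" "f q = a" "p \<in> S" "q \<in> S" using pq A by auto
  define B where "B b = {i \<in> S. f i = b}" for b
  define L M R where "L b = {i \<in> B b. i < p}" and "M b = {i \<in> B b. p < i \<and> i < q}"
    and "R b = {i \<in> B b. q < i}" for b
  have finB [simp]: "finite (B b)" "finite (L b)" "finite (M b)" "finite (R b)" for b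
    using fin by (simp_all add: B_def L_def M_def R_def)
  \<comment> \<open>Every destroyed copy whose middle \<open>y\<close> lies outside \<open>A\<close> consists of \<open>y\<close>, some \<open>x\<close> in \<open>A\<close>, and the
    extreme on the other side of \<open>y\<close>. Taking \<open>x \<noteq> p\<close> avoids counting \<open>(p, y, q)\<close> twice.\<close>
  define with_extreme where "with_extreme = (\<lambda>(y, x). if x > y then (p, y, x) else (x, y, q))"
  \<comment> \<open>All destroyed copies whose letter other than \<open>a\<close> is \<open>b\<close>, by middle: in class \<open>b\<close>, \<open>p\<close>, \<open>q\<close>.\<close>
  define lost where "lost b =
      with_extreme ` (M b \<times> (A - {p}))
      \<union> (\<lambda>(i, k). (i, p, k)) ` (L b \<times> (M b \<union> R b))
      \<union> (\<lambda>(i, k). (i, q, k)) ` ((L b \<union> M b) \<times> R b)" for b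
  have fin_lost: "finite (lost b)" for b using finA by (simp add: lost_def)
  have card_lost: "card (lost b) \<le> card (B b) * (card A - 1)" if b: "b \<noteq> a" for b
  proof -
    have notA: "i \<noteq> p \<and> i \<noteq> q" if "i \<in> B b" for i using that b fpq by (auto simp: B_def)
    have pleq: "p \<le> q" using le pq by blast
    have disj: "L b \<inter> M b = {}" "(L b \<union> M b) \<inter> R b = {}" "M b \<inter> R b = {}"
      using pleq by (auto simp: L_def M_def R_def)
    have "B b = L b \<union> M b \<union> R b"
    proof
      show "B b \<subseteq> L b \<union> M b \<union> R b"
      proof
        fix i assume i: "i \<in> B b"
        then have "i \<noteq> p" "i \<noteq> q" using notA by blast+
        then have "i < p \<or> p < i \<and> i < q \<or> q < i" by force
        then show "i \<in> L b \<union> M b \<union> R b" using i by (auto simp: L_def M_def R_def)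
      qed
    qed (auto simp: L_def M_def R_def)
    then have cardB: "card (B b) = card (L b) + card (M b) + card (R b)"
      using disj by (simp add: card_Un_disjoint)
    have "card (lost b) \<le> card (M b \<times> (A - {p})) + card (L b \<times> (M b \<union> R b))
        + card ((L b \<union> M b) \<times> R b)"
      unfolding lost_def
      by (intro order_trans[OF card_Un_le] add_mono card_image_le) (auto simp: finA)
    also have "\<dots> = card (M b) * (card A - 1) + card (L b) * (card (M b) + card (R b))
        + (card (L b) + card (M b)) * card (R b)"
      using disj pq finA by (simp add: card_cartesian_product card_Un_disjoint)
    also have "\<dots> \<le> card (B b) * (card A - 1)"
      unfolding cardB by (rule removal_loss_arith) (use cardB largest[of b] in \<open>simp add: B_def\<close>)
    finally show ?thesis .
  qed
  let ?C = "f ` S - {a}"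
  have cover: "copies_121 f S \<subseteq> copies_121 f (S - {p, q}) \<union> (\<Union>b\<in>?C. lost b)"
  proof
    fix t assume t: "t \<in> copies_121 f S"
    obtain i j k where ijk: "t = (i, j, k)" by (cases t)
    have h: "i \<in> S" "j \<in> S" "k \<in> S" "i < j" "j < k" "f i = f k" "f j \<noteq> f i"
      using t ijk by (auto simp: copies_121_def)
    show "t \<in> copies_121 f (S - {p, q}) \<union> (\<Union>b\<in>?C. lost b)"
    proof (cases "t \<in> copies_121 f (S - {p, q})")
      case False
      then have hit: "i \<in> {p, q} \<or> j \<in> {p, q} \<or> k \<in> {p, q}"
        using h ijk by (auto simp: copies_121_def)
      show ?thesis
      proof (cases "f j = a")
        case True
        then have fi: "f i \<noteq> a" using h by simp
        have j: "j = p \<or> j = q" using hit fi h fpq by auto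
        have ik: "i \<in> B (f i)" "k \<in> B (f i)" "k \<noteq> p" "k \<noteq> q" "i \<noteq> p" "i \<noteq> q" using h fi fpq by (auto simp: B_def)
        from j have "t \<in> lost (f i)"
        proof
          assume "j = p"
          then have "i \<in> L (f i)" "k \<in> M (f i) \<union> R (f i)" using h ik by (auto simp: L_def M_def R_def)
          then show ?thesis using ijk \<open>j = p\<close> by (auto simp: lost_def)
        next
          assume "j = q"
          then have "i \<in> L (f i) \<union> M (f i)" "k \<in> R (f i)" using h ik by (auto simp: L_def M_def R_def)
          then show ?thesis using ijk \<open>j = q\<close> by (auto simp: lost_def)
        qed
        then show ?thesis using fi h by auto
      next
        case False
        \<comment> \<open>A copy with outer letter \<open>a\<close> meets \<open>p\<close> only in its first and \<open>q\<close> only in its last position.\<close>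
        have ends: "i = p \<or> k = q" and ikA: "i \<in> A" "k \<in> A"
        proof -
          have "i \<in> {p, q} \<or> k \<in> {p, q}" using hit False fpq by auto
          then have "f i = a" using h fpq by auto
          then show ikA: "i \<in> A" "k \<in> A" using h A by auto
          show "i = p \<or> k = q"
            using \<open>i \<in> {p, q} \<or> k \<in> {p, q}\<close> le[OF ikA(1)] le[OF ikA(2)] h by auto
        qed
        have "j \<in> M (f j)" using le[OF ikA(1)] le[OF ikA(2)] h by (auto simp: M_def B_def)
        have "t \<in> lost (f j)"
        proof (cases "i = p")
          case True
          have "k \<in> A - {p}" using ikA h True by auto
          then have "(j, k) \<in> M (f j) \<times> (A - {p})" using \<open>j \<in> M (f j)\<close> by simp
          moreover have "t = with_extreme (j, k)" using h ijk True by (simp add: with_extreme_def)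
          ultimately show ?thesis unfolding lost_def by blast
        next
          case False
          then have "(j, i) \<in> M (f j) \<times> (A - {p})" using \<open>j \<in> M (f j)\<close> ikA by simp
          moreover have "t = with_extreme (j, i)" using h ijk False ends by (simp add: with_extreme_def)
          ultimately show ?thesis unfolding lost_def by blast
        qed
        then show ?thesis using False h by auto
      qed
    qed simp
  qed
  have sumB: "(\<Sum>b\<in>?C. card (B b)) = card S - card A"
  proof -
    have "(\<Sum>b\<in>?C. card (B b)) = card (\<Union>b\<in>?C. B b)"
      using fin by (intro card_UN_disjoint[symmetric]) (auto simp: B_def)
    also have "(\<Union>b\<in>?C. B b) = S - A" by (auto simp: B_def A)
    also have "card (S - A) = card S - card A" by (rule card_Diff_subset) (auto simp: A fin)
    finally show ?thesis .
  qed
  have "card (copies_121 f S) \<le> card (copies_121 f (S - {p, q}) \<union> (\<Union>b\<in>?C. lost b))"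
    using fin fin_lost by (intro card_mono cover) (auto simp: finite_copies_121)
  also have "\<dots> \<le> card (copies_121 f (S - {p, q})) + card (\<Union>b\<in>?C. lost b)"
    by (rule card_Un_le)
  also have "card (\<Union>b\<in>?C. lost b) \<le> (\<Sum>b\<in>?C. card (lost b))"
    using fin by (intro card_UN_le) auto
  also have "\<dots> \<le> (\<Sum>b\<in>?C. card (B b) * (card A - 1))"
    by (intro sum_mono card_lost) auto
  also have "\<dots> = (card S - card A) * (card A - 1)"
    by (simp add: sumB flip: sum_distrib_right)
  finally show ?thesis by (simp add: p_def q_def)
qed

section \<open>The bound for arbitrary words\<close>

lemma card_copies_121_le:
  fixes f :: "'i::linorder \<Rightarrow> 'a"
  assumes "finite S"
  shows "card (copies_121 f S) \<le> alternating_total (card S)"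
  using assms
proof (induction "card S" arbitrary: S rule: less_induct)
  case less
  show ?case
  proof (cases "copies_121 f S = {}")
    case False
    then obtain i j k where ik: "i \<in> S" "k \<in> S" "i < j" "j < k" "f i = f k"
      by (auto simp: copies_121_def)
    let ?c = "\<lambda>b. card {x \<in> S. f x = b}"
    have finc: "finite (?c ` f ` S)" "?c ` f ` S \<noteq> {}" using less.prems ik by auto
    obtain a where a: "Max (?c ` f ` S) = ?c a" "a \<in> f ` S"
      using Max_in[OF finc] by (rule imageE)
    define A where "A = {x \<in> S. f x = a}"
    have largest: "?c b \<le> card A" for b
    proof (cases "b \<in> f ` S")
      case True
      then show ?thesis unfolding A_def a(1)[symmetric] using finc by (intro Max_ge) simp_all
    next
      case False
      then have "{x \<in> S. f x = b} = {}" by auto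
      then show ?thesis by (simp only: card.empty le0)
    qed
    have finA: "finite A" and "A \<subseteq> S" and "A \<noteq> {}" using less.prems a(2) by (auto simp: A_def)
    \<comment> \<open>The outer letter of a copy occurs twice, so the two extremes of \<open>A\<close> are distinct.\<close>
    have "card {i, k} \<le> ?c (f i)"
      using less.prems ik by (intro card_mono) auto
    then have two: "2 \<le> card A" using ik largest[of "f i"] by auto
    have "Min A \<noteq> Max A"
    proof
      assume "Min A = Max A"
      then have "A \<subseteq> {Min A}"
        using finA by (metis Max_ge Min_le antisym singletonI subsetI)
      then have "card A \<le> 1" using card_mono[of "{Min A}" A] by simp
      with two show False by simp
    qed
    then have rest: "card (S - {Min A, Max A}) = card S - 2"
      using finA \<open>A \<noteq> {}\<close> \<open>A \<subseteq> S\<close> Min_in Max_in by (subst card_Diff_subset) auto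
    have le: "card A \<le> card S" using \<open>A \<subseteq> S\<close> less.prems by (rule card_mono[rotated])
    define n where "n = card S - 2"
    have n: "card S = n + 2" using le two by (simp add: n_def)
    have "card (copies_121 f S)
        \<le> card (copies_121 f (S - {Min A, Max A})) + (card S - card A) * (card A - 1)"
      using less.prems A_def \<open>A \<noteq> {}\<close> largest by (rule card_copies_121_remove_extremes)
    also have "card (copies_121 f (S - {Min A, Max A})) \<le> alternating_total n"
      using less.hyps[of "S - {Min A, Max A}"] less.prems rest n by simp
    also have "(card S - card A) * (card A - 1) \<le> (n + 1) div 2 * ((n + 2) div 2)"
      using mult_le_balanced[of "card S - card A" "card A - 1"] le two n by simp
    finally show ?thesis by (simp only: n alternating_total_step add_mono)
  qed simp
qed

theorem theorem4p4:
  fixes n :: nat and \<pi> :: "nat list"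
  assumes "n \<ge> 1"
    and "\<pi> \<in> set_partitions n"
  shows "pattern_count [1, 2, 1] \<pi> \<le> pattern_count [1, 2, 1] (alternating_partition n)"
proof -
  have "length \<pi> = n" using assms(2) by (simp add: set_partitions_def)
  then have "pattern_count [1, 2, 1] \<pi> \<le> alternating_total n"
    using card_copies_121_le[of "{..<n}" "\<lambda>i. \<pi> ! i"]
    by (simp only: pattern_count_121_eq_card_copies finite_lessThan card_lessThan simp_thms)
  also have "\<dots> \<le> pattern_count [1, 2, 1] (alternating_partition n)"
    unfolding pattern_count_121_alternating by (rule alternating_total_le_card_copies)
  finally show ?thesis .
qed

end
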